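(* Let $t$ be a real number, let $x>1$, let $m\ge 0$ and $n\ge 1$ be integers, and let $\alpha_0,\alpha_1,\dots,\alpha_m$ be real numbers. Then $$S_2(t,x;m,1,n;\alpha_0,\dots,\alpha_m)=\left(\frac{1-x}{2}t\right)\sum_{j=0}^{m}\alpha_j\sum_{l=0}^{j}\binom{j}{l}\left(-\frac{2}{n}\right)^{j-l}e^{\frac{1+x}{2}t}\sum_{c=0}^{l}\mathcal{S}_2(l+1,c+1)\left(\frac{1+x}{2}t\right)^{c}.$$
   Context: For $\beta\in\mathbb{C}$ and an integer $r\ge 0$, $(\beta)^{\overline{r}}=\prod_{j=0}^{r-1}(\beta+j)$, with $(\beta)^{\overline{0}}=1$. The generalized hypergeometric function is $${}_pF_q\left[\begin{array}{c}\beta_1,\dots,\beta_p\\ \gamma_1,\dots,\gamma_q\end{array};z\right]=\sum_{r=0}^{\infty}\frac{\prod_{j=1}^{p}(\beta_j)^{\overline{r}}}{\prod_{j=1}^{q}(\gamma_j)^{\overline{r}}}\frac{z^r}{r!},\qquad {}_0F_0(z)=e^z.$$ For integers $m\ge 0$, $k,n\ge 1$, and real $t,x,\alpha_0,\dots,\alpha_m$, define $$S_2(t,x;m,k,n;\alpha_0,\dots,\alpha_m)=\frac{1}{k!}\left(\frac{1-x}{2}t\right)^{k}\sum_{j=0}^{m}\alpha_j\sum_{l=0}^{j}\binom{j}{l}\left(-\frac{2k}{n}\right)^{j-l}\,{}_lF_l\left[\begin{array}{c}k+1,\dots,k+1\\ k,\dots,k\end{array};\frac{1+x}{2}t\right],$$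 where in ${}_lF_l$ all $l$ upper parameters equal $k+1$ and all $l$ lower parameters equal $k$. The Stirling numbers of the second kind are $\mathcal{S}_2(c,d)=\frac{1}{d!}\sum_{v=0}^{d}\binom{d}{v}(-1)^v(d-v)^c$, with $0^0=1$. *)

theory Defs
  imports "HOL-Analysis.Analysis" "HOL-Combinatorics.Stirling"
begin

(* The rising factorial is the library's pochhammer.  As with every suminf, the value
   is meaningful only where the series converges; terms with a vanishing lower
   Pochhammer symbol are 0 by the convention x / 0 = 0. *)
definition hypergeometric :: "'a list \<Rightarrow> 'a list \<Rightarrow> 'a \<Rightarrow> 'a::{real_normed_field,banach}" where
  "hypergeometric \<beta>s \<gamma>s z =
     (\<Sum>r. (\<Prod>\<beta>\<leftarrow>\<beta>s. pochhammer \<beta> r) / (\<Prod>\<gamma>\<leftarrow>\<gamma>s. pochhammer \<gamma> r) * (z ^ r / fact r))"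

lemma hypergeometric_0_0: "hypergeometric [] [] z = exp z"
  by (simp add: hypergeometric_def exp_def scaleR_conv_of_real field_simps)

definition S2 :: "real \<Rightarrow> real \<Rightarrow> nat \<Rightarrow> nat \<Rightarrow> nat \<Rightarrow> (nat \<Rightarrow> real) \<Rightarrow> real" where
  "S2 t x m k n \<alpha> =
     1 / fact k * ((1 - x) / 2 * t) ^ k *
     (\<Sum>j=0..m. \<alpha> j * (\<Sum>l=0..j. real (j choose l) * (- (2 * real k / real n)) ^ (j - l) *
        hypergeometric (replicate l (real k + 1)) (replicate l (real k)) ((1 + x) / 2 * t)))"

(* The explicit formula; the convention 0 ^ 0 = 1 is the one of the library. *)
definition stirling2 :: "nat \<Rightarrow> nat \<Rightarrow> real" where
  "stirling2 c d =
     1 / fact d * (\<Sum>v=0..d. real (d choose v) * (-1) ^ v * real (d - v) ^ c)"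

lemma stirling2_rec:
  "stirling2 (Suc n) (Suc d) = real (Suc d) * stirling2 n (Suc d) + stirling2 n d"
proof -
  define f where
    "f c d = (\<Sum>v=0..d. real (d choose v) * (-1) ^ v * real (d - v) ^ c)" for c d
  define g where "g = (\<Sum>v=0..d. real (d choose v) * (-1) ^ v * real (Suc d - v) ^ n)"
  have f1: "f (Suc n) (Suc d) = real (Suc d) * g"
  proof -
    have absorb: "real (Suc d choose v) * real (Suc d - v) = real (Suc d) * real (d choose v)"
      if "v \<le> d" for v
      using binomial_absorb_comp[of "Suc d" v]
      by (metis diff_Suc_1 mult.commute of_nat_mult)
    have "f (Suc n) (Suc d) =
        (\<Sum>v=0..d. real (Suc d choose v) * (-1) ^ v * real (Suc d - v) ^ Suc n)"
      by (simp add: f_def)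
    also have "\<dots> = (\<Sum>v=0..d. real (Suc d) * (real (d choose v) * (-1) ^ v * real (Suc d - v) ^ n))"
    proof (rule sum.cong[OF refl])
      fix v assume "v \<in> {0..d}"
      then have "v \<le> d" by simp
      have "real (Suc d choose v) * (-1) ^ v * real (Suc d - v) ^ Suc n =
          (real (Suc d choose v) * real (Suc d - v)) * (-1) ^ v * real (Suc d - v) ^ n"
        by (simp only: power_Suc mult_ac)
      also have "\<dots> = real (Suc d) * (real (d choose v) * (-1) ^ v * real (Suc d - v) ^ n)"
        by (simp only: absorb[OF \<open>v \<le> d\<close>] mult_ac)
      finally show "real (Suc d choose v) * (-1) ^ v * real (Suc d - v) ^ Suc n =
          real (Suc d) * (real (d choose v) * (-1) ^ v * real (Suc d - v) ^ n)" .
    qed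
    finally show ?thesis by (simp only: g_def sum_distrib_left)
  qed
  have f2: "f n (Suc d) = g - f n d"
  proof -
    let ?h = "\<lambda>v. (-1) ^ v * real (Suc d - v) ^ n"
    have "f n (Suc d) = ?h 0 + (\<Sum>v=0..d. real (Suc d choose Suc v) * ?h (Suc v))"
      unfolding f_def sum.atLeast0_atMost_Suc_shift by (simp add: mult.assoc o_def)
    also have "(\<Sum>v=0..d. real (Suc d choose Suc v) * ?h (Suc v)) =
        (\<Sum>v=0..d. real (d choose Suc v) * ?h (Suc v)) + (\<Sum>v=0..d. real (d choose v) * ?h (Suc v))"
      by (simp only: binomial_Suc_Suc of_nat_add distrib_right sum.distrib add.commute)
    also have "(\<Sum>v=0..d. real (d choose v) * ?h (Suc v)) = - f n d"
      by (simp add: f_def sum_negf mult.assoc)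
    also have "?h 0 + ((\<Sum>v=0..d. real (d choose Suc v) * ?h (Suc v)) + - f n d) =
        (\<Sum>v=0..Suc d. real (d choose v) * ?h v) - f n d"
      unfolding sum.atLeast0_atMost_Suc_shift by (simp add: o_def)
    also have "(\<Sum>v=0..Suc d. real (d choose v) * ?h v) = g"
      by (simp add: g_def mult.assoc)
    finally show ?thesis .
  qed
  have "stirling2 (Suc n) (Suc d) = real (Suc d) * (f n (Suc d) + f n d) / fact (Suc d)"
    using f1 f2 by (simp add: stirling2_def f_def)
  also have "\<dots> = real (Suc d) * (f n (Suc d) / fact (Suc d)) + f n d / fact d"
    by (simp add: divide_simps del: of_nat_Suc)
  finally show ?thesis by (simp add: stirling2_def f_def)
qed

lemma stirling2_eq_Stirling: "stirling2 n k = real (Stirling n k)"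
proof (induction n k rule: Stirling.induct)
  case (2 k)
  have "(\<Sum>v\<le>Suc k. (-1) ^ v * real (Suc k choose v)) = 0"
    by (rule choose_alternating_sum) simp
  then show ?case
    by (simp add: stirling2_def atLeast0AtMost mult.commute del: sum.atMost_Suc)
next
  case (4 n k)
  then show ?case by (simp add: stirling2_rec algebra_simps)
qed (simp_all add: stirling2_def)

end

theory Submission
  imports Defs
begin

text \<open>
  With upper parameters \<open>2\<close> and lower parameters \<open>1\<close>, the quotient of Pochhammer symbols is
  \<open>pochhammer 2 r / pochhammer 1 r = r + 1\<close>.  The hypergeometric function in question is
  therefore \<open>\<Sum>r. (r + 1)\<^sup>l z\<^sup>r / r!\<close>.  Stirling numbers of the second kind convert the power
  \<open>(r + 1)\<^sup>l\<close> into a combination of the falling factorials \<open>r (r - 1) \<dots> (r - c + 1)\<close>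
  (\<open>Suc_power_eq_sum_Stirling\<close>), and each of these has a trivial exponential generating
  function, \<open>z\<^sup>c e\<^sup>z\<close> (\<open>falling_factorial_exp_sums\<close>), because it cancels the largest \<open>c\<close> factors
  of \<open>r!\<close>.  Summing over \<open>c\<close> yields a closed form for \<open>\<^sub>lF\<^sub>l\<close>, which is substituted into
  the definition of \<open>S2\<close>.
\<close>

text \<open>
  The falling factorial is written as \<open>c! (r choose c)\<close>.  Multiplication by \<open>r + 1\<close> acts on it
  by \<open>(r + 1) c! (r choose c) = (c + 1) c! (r choose c) + (c + 1)! (r choose (c + 1))\<close>, so the
  coefficients obey the Stirling recurrence.  The shift of both indices by one comes from expanding
  \<open>(r + 1)\<^sup>l\<^sup>+\<^sup>1\<close> in falling factorials of \<open>r + 1\<close> and cancelling the common factor \<open>r + 1\<close>.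
\<close>

lemma Suc_power_eq_sum_Stirling:
  "Suc r ^ l = (\<Sum>c\<le>l. Stirling (Suc l) (Suc c) * (fact c * (r choose c)))"
proof (induction l)
  case 0
  show ?case by simp
next
  case (Suc l)
  define b :: "nat \<Rightarrow> nat" where "b c = fact c * (r choose c)" for c
  have b_step: "Suc r * b c = Suc c * b c + b (Suc c)" for c
  proof -
    have "Suc r * b c = fact c * (Suc r * (r choose c))"
      by (simp only: b_def mult_ac)
    also have "\<dots> = fact c * (Suc c * (Suc r choose Suc c))"
      by (simp only: Suc_times_binomial_eq mult.commute)
    also have "\<dots> = Suc c * b c + b (Suc c)"
      by (simp add: b_def algebra_simps)
    finally show ?thesis .
  qed
  have "Suc r ^ Suc l = (\<Sum>c\<le>l. Stirling (Suc l) (Suc c) * (Suc r * b c))"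
    by (simp only: power_Suc Suc.IH b_def sum_distrib_left mult.left_commute)
  also have "\<dots> = (\<Sum>c\<le>l. Suc c * Stirling (Suc l) (Suc c) * b c)
      + (\<Sum>c\<le>l. Stirling (Suc l) (Suc c) * b (Suc c))"
    by (simp only: b_step distrib_left sum.distrib mult_ac)
  \<comment> \<open>Both sums extend to \<open>c \<le> l + 1\<close>: the added terms carry \<open>Stirling (l + 1) (l + 2) = 0\<close>
      and, after shifting the index of the second sum, \<open>Stirling (l + 1) 0 = 0\<close>.\<close>
  also have "(\<Sum>c\<le>l. Suc c * Stirling (Suc l) (Suc c) * b c)
      = (\<Sum>c\<le>Suc l. Suc c * Stirling (Suc l) (Suc c) * b c)"
    by (simp add: Stirling_less del: Stirling.simps)
  also have "(\<Sum>c\<le>l. Stirling (Suc l) (Suc c) * b (Suc c))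
      = (\<Sum>c\<le>Suc l. Stirling (Suc l) c * b c)"
    by (subst sum.atMost_Suc_shift) simp
  also have "(\<Sum>c\<le>Suc l. Suc c * Stirling (Suc l) (Suc c) * b c)
      + (\<Sum>c\<le>Suc l. Stirling (Suc l) c * b c)
      = (\<Sum>c\<le>Suc l. Stirling (Suc (Suc l)) (Suc c) * b c)"
    by (simp only: Stirling.simps(4) distrib_right sum.distrib)
  finally show ?case by (simp only: b_def)
qed

text \<open>
  The terms with \<open>r < c\<close> vanish, and the remaining ones are \<open>z\<^sup>c\<close> times the exponential series,
  since \<open>c! (r choose c) / r! = 1 / (r - c)!\<close>.
\<close>

lemma falling_factorial_exp_sums:
  fixes z :: "'a::{real_normed_field,banach}"
  shows "(\<lambda>r. of_nat (fact c * (r choose c)) * (z ^ r / fact r)) sums (z ^ c * exp z)"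
proof -
  let ?f = "\<lambda>r. of_nat (fact c * (r choose c)) * (z ^ r / fact r)"
  have shifted: "?f (r + c) = z ^ c * (z ^ r / fact r)" for r
  proof -
    have "(of_nat (fact c * (r + c choose c)) :: 'a) = fact (r + c) / fact r"
      by (simp add: binomial_fact)
    then show ?thesis by (simp add: power_add)
  qed
  have "(\<lambda>r. z ^ r / fact r) sums exp z"
    using exp_converges[of z] by (simp add: scaleR_conv_of_real field_simps)
  then have "(\<lambda>r. ?f (r + c)) sums (z ^ c * exp z)"
    unfolding shifted by (rule sums_mult)
  then show ?thesis
    by (subst (asm) sums_zero_iff_shift) simp_all
qed

lemma Suc_power_exp_sums:
  fixes z :: "'a::{real_normed_field,banach}"
  shows "(\<lambda>r. of_nat (Suc r) ^ l * (z ^ r / fact r))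
    sums (exp z * (\<Sum>c\<le>l. of_nat (Stirling (Suc l) (Suc c)) * z ^ c))"
proof -
  have "(\<lambda>r. \<Sum>c\<le>l. of_nat (Stirling (Suc l) (Suc c)) *
        (of_nat (fact c * (r choose c)) * (z ^ r / fact r)))
      sums (\<Sum>c\<le>l. of_nat (Stirling (Suc l) (Suc c)) * (z ^ c * exp z))"
    by (intro sums_sum sums_mult falling_factorial_exp_sums)
  moreover have "(\<Sum>c\<le>l. of_nat (Stirling (Suc l) (Suc c)) *
        (of_nat (fact c * (r choose c)) * (z ^ r / fact r)))
      = of_nat (Suc r) ^ l * (z ^ r / fact r)" for r
    unfolding of_nat_power[symmetric] Suc_power_eq_sum_Stirling
    by (simp only: of_nat_sum of_nat_mult sum_distrib_right mult.assoc)
  moreover have "(\<Sum>c\<le>l. of_nat (Stirling (Suc l) (Suc c)) * (z ^ c * exp z))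
      = exp z * (\<Sum>c\<le>l. of_nat (Stirling (Suc l) (Suc c)) * z ^ c)"
    by (simp only: sum_distrib_left mult_ac)
  ultimately show ?thesis by (simp only:)
qed

lemma pochhammer_2_div_pochhammer_1:
  "pochhammer 2 r / pochhammer 1 r = (of_nat (Suc r) :: 'a::field_char_0)"
proof -
  have "pochhammer 2 r = (fact (Suc r) :: 'a)"
    using pochhammer_rec[of "1::'a" r] by (simp only: pochhammer_fact one_add_one mult_1)
  then show ?thesis
    by (simp add: pochhammer_fact[symmetric])
qed

lemma hypergeometric_replicate_2_1:
  fixes z :: "'a::{real_normed_field,banach}"
  shows "hypergeometric (replicate l 2) (replicate l 1) z
    = exp z * (\<Sum>c\<le>l. of_nat (Stirling (Suc l) (Suc c)) * z ^ c)"
proof -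
  have "hypergeometric (replicate l 2) (replicate l 1) z
      = (\<Sum>r. of_nat (Suc r) ^ l * (z ^ r / fact r))"
    unfolding hypergeometric_def
    by (simp only: map_replicate prod_list_replicate power_divide[symmetric]
        pochhammer_2_div_pochhammer_1)
  also have "\<dots> = exp z * (\<Sum>c\<le>l. of_nat (Stirling (Suc l) (Suc c)) * z ^ c)"
    by (rule sums_unique[OF Suc_power_exp_sums, symmetric])
  finally show ?thesis .
qed

theorem corollary2p17:
  fixes t x :: real and m n :: nat and \<alpha> :: "nat \<Rightarrow> real"
  assumes "x > 1" and "n \<ge> 1"
  shows "S2 t x m 1 n \<alpha> =
    ((1 - x) / 2 * t) *
    (\<Sum>j=0..m. \<alpha> j * (\<Sum>l=0..j. real (j choose l) * (- (2 / real n)) ^ (j - l) *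
       exp ((1 + x) / 2 * t) *
       (\<Sum>c=0..l. stirling2 (l + 1) (c + 1) * ((1 + x) / 2 * t) ^ c)))"
proof -
  have "hypergeometric (replicate l (real 1 + 1)) (replicate l (real 1)) z
      = exp z * (\<Sum>c=0..l. stirling2 (l + 1) (c + 1) * z ^ c)" for l and z :: real
    using hypergeometric_replicate_2_1[of l z]
    by (simp add: stirling2_eq_Stirling atLeast0AtMost del: Stirling.simps)
  then show ?thesis
    unfolding S2_def by (simp add: mult.assoc)
qed

end
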